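(* Given a loop-free digraph $D=(V,A)$ and a subset $X\subseteq V$, it can be decided in polynomial time whether the arc set $A$ can be partitioned into an acyclic subgraph and an in-branching in which all vertices in $X$ are roots. Such a partition exists if and only if there does not exist a nonempty induced subgraph $D'=(V',A')$ of $D$ in which the outdegree of each vertex $v\in V'\cap X$ is at least $1$ and the outdegree of each vertex $v\in V'\setminus X$ is at least $2$.
   Context: Digraphs are finite and loop-free; parallel arcs are allowed (and counted with multiplicity in degrees). An in-branching of $D=(V,A)$ is a set of arcs $B\subseteq A$ containing no directed cycle and such that every vertex has at most one outgoing arc in $B$. A root of $B$ is a vertex with no outgoing arc in $B$ (isolated vertices are roots). The in-branching may have roots other than the vertices of $X$. A subgraph is acyclic if it contains no directed cycle. Either part of the partition may be empty. *)

theory Defs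
  imports
    "Graph_Theory.Digraph_Component"
    "HOL-Computational_Algebra.Polynomial"
    "HOL-Library.Discrete_Functions"
begin

section \<open>Acyclic subgraphs and in-branchings\<close>

text \<open>A set of arcs of \<open>G\<close> is treated as the spanning subgraph \<open>G\<lparr>arcs := S\<rparr>\<close>.\<close>

definition acyclic_arcs :: "('a, 'b) pre_digraph \<Rightarrow> 'b set \<Rightarrow> bool" where
  "acyclic_arcs G S \<longleftrightarrow> S \<subseteq> arcs G \<and> (\<nexists>p. pre_digraph.cycle (G\<lparr>arcs := S\<rparr>) p)"

definition in_branching :: "('a, 'b) pre_digraph \<Rightarrow> 'b set \<Rightarrow> bool" where
  "in_branching G B \<longleftrightarrow>
     acyclic_arcs G B \<and> (\<forall>v \<in> verts G. out_degree (G\<lparr>arcs := B\<rparr>) v \<le> 1)"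

definition branching_roots :: "('a, 'b) pre_digraph \<Rightarrow> 'b set \<Rightarrow> 'a set" where
  "branching_roots G B = {v \<in> verts G. out_arcs (G\<lparr>arcs := B\<rparr>) v = {}}"

definition has_acyclic_in_branching_partition :: "('a, 'b) pre_digraph \<Rightarrow> 'a set \<Rightarrow> bool" where
  "has_acyclic_in_branching_partition G X \<longleftrightarrow>
     (\<exists>F B. F \<union> B = arcs G \<and> F \<inter> B = {} \<and>
        acyclic_arcs G F \<and> in_branching G B \<and> X \<subseteq> branching_roots G B)"


section \<open>Polynomial time\<close>

text \<open>
  The machine model is the random access machine of Cook and Reckhow with
  logarithmic cost, which is polynomially equivalent to Turing machines.
  Registers hold natural numbers (so subtraction is truncated), the input is a
  sequence of natural numbers that is read sequentially, and jump targets are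
  absolute positions in the program.
\<close>

datatype ram_instr =
    Const nat nat       \<comment> \<open>\<open>X\<^sub>i \<leftarrow> c\<close>\<close>
  | Add nat nat nat     \<comment> \<open>\<open>X\<^sub>i \<leftarrow> X\<^sub>j + X\<^sub>k\<close>\<close>
  | Sub nat nat nat     \<comment> \<open>\<open>X\<^sub>i \<leftarrow> X\<^sub>j - X\<^sub>k\<close>\<close>
  | Load nat nat        \<comment> \<open>\<open>X\<^sub>i \<leftarrow> X[X\<^sub>j]\<close>\<close>
  | Store nat nat       \<comment> \<open>\<open>X[X\<^sub>i] \<leftarrow> X\<^sub>j\<close>\<close>
  | Read nat            \<comment> \<open>\<open>X\<^sub>i \<leftarrow>\<close> next input number\<close>
  | JumpPos nat nat     \<comment> \<open>jump to position \<open>l\<close> if \<open>X\<^sub>i > 0\<close>\<close>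

record ram_config =
  pc :: nat
  mem :: "nat \<Rightarrow> nat"
  inp :: "nat list"

text \<open>Reading past the end of the input yields 0.\<close>

fun next_input :: "nat list \<Rightarrow> nat" where
  "next_input [] = 0"
| "next_input (x # xs) = x"

fun ram_exec :: "ram_instr \<Rightarrow> ram_config \<Rightarrow> ram_config" where
  "ram_exec (Const i c) s = s\<lparr>pc := Suc (pc s), mem := (mem s)(i := c)\<rparr>"
| "ram_exec (Add i j k) s = s\<lparr>pc := Suc (pc s), mem := (mem s)(i := mem s j + mem s k)\<rparr>"
| "ram_exec (Sub i j k) s = s\<lparr>pc := Suc (pc s), mem := (mem s)(i := mem s j - mem s k)\<rparr>"
| "ram_exec (Load i j) s = s\<lparr>pc := Suc (pc s), mem := (mem s)(i := mem s (mem s j))\<rparr>"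
| "ram_exec (Store i j) s = s\<lparr>pc := Suc (pc s), mem := (mem s)(mem s i := mem s j)\<rparr>"
| "ram_exec (Read i) s =
     s\<lparr>pc := Suc (pc s), mem := (mem s)(i := next_input (inp s)), inp := tl (inp s)\<rparr>"
| "ram_exec (JumpPos i l) s = s\<lparr>pc := (if mem s i > 0 then l else Suc (pc s))\<rparr>"

text \<open>The length of the binary representation; it is 1 for 0.\<close>

definition bit_size :: "nat \<Rightarrow> nat" where
  "bit_size n = Suc (floor_log n)"

fun ram_cost :: "ram_instr \<Rightarrow> ram_config \<Rightarrow> nat" where
  "ram_cost (Const i c) s = bit_size c"
| "ram_cost (Add i j k) s = bit_size (mem s j) + bit_size (mem s k)"
| "ram_cost (Sub i j k) s = bit_size (mem s j) + bit_size (mem s k)"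
| "ram_cost (Load i j) s = bit_size (mem s j) + bit_size (mem s (mem s j))"
| "ram_cost (Store i j) s = bit_size (mem s i) + bit_size (mem s j)"
| "ram_cost (Read i) s = bit_size (next_input (inp s))"
| "ram_cost (JumpPos i l) s = bit_size (mem s i)"

text \<open>\<open>ram_run P s t s'\<close>: the program \<open>P\<close> leads from \<open>s\<close> to \<open>s'\<close> with total cost \<open>t\<close>.\<close>

inductive ram_run :: "ram_instr list \<Rightarrow> ram_config \<Rightarrow> nat \<Rightarrow> ram_config \<Rightarrow> bool" for P where
  refl: "ram_run P s 0 s"
| step: "pc s < length P \<Longrightarrow> ram_run P (ram_exec (P ! pc s) s) t s' \<Longrightarrow>
    ram_run P s (ram_cost (P ! pc s) s + t) s'"

definition ram_init :: "nat list \<Rightarrow> ram_config" where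
  "ram_init w = \<lparr>pc = 0, mem = (\<lambda>_. 0), inp = w\<rparr>"

text \<open>A program halts by leaving its code; register 0 then holds the output.\<close>

definition ram_computes :: "ram_instr list \<Rightarrow> nat list \<Rightarrow> nat \<Rightarrow> nat \<Rightarrow> bool" where
  "ram_computes P w t r \<longleftrightarrow>
     (\<exists>s. ram_run P (ram_init w) t s \<and> length P \<le> pc s \<and> mem s 0 = r)"

definition input_size :: "nat list \<Rightarrow> nat" where
  "input_size w = sum_list (map bit_size w)"

text \<open>
  \<open>poly_time_decidable enc I Q\<close>: the question \<open>Q\<close> about instances in \<open>I\<close>, presented to
  the machine by \<open>enc\<close>, is decidable in polynomial time.
\<close>

definition poly_time_decidable :: "('i \<Rightarrow> nat list) \<Rightarrow> 'i set \<Rightarrow> ('i \<Rightarrow> bool) \<Rightarrow> bool" where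
  "poly_time_decidable enc I Q \<longleftrightarrow>
     (\<exists>P. \<exists>p :: nat poly. \<forall>x \<in> I. \<exists>t \<le> poly p (input_size (enc x)).
        ram_computes P (enc x) t (if Q x then 1 else 0))"


section \<open>Digraphs with a vertex set as machine input\<close>

text \<open>
  For input to a machine, the vertices are numbered \<open>0, \<dots>, n - 1\<close> and the arcs
  \<open>0, \<dots>, m - 1\<close>, which loses no generality.
\<close>

definition digraph_instances :: "((nat, nat) pre_digraph \<times> nat set) set" where
  "digraph_instances = {(G, X). fin_digraph G \<and> loopfree_digraph G \<and> X \<subseteq> verts G \<and>
     (\<exists>n m. verts G = {..<n} \<and> arcs G = {..<m})}"

text \<open>
  The encoding consists of \<open>n\<close>, \<open>m\<close>, the characteristic sequence of \<open>X\<close>, and the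
  list of arcs, each given by its tail and its head. Its length is \<open>2 + n + 2 * m\<close>,
  so no exponentially large vertex or arc set has a short encoding.
\<close>

definition encode_instance :: "(nat, nat) pre_digraph \<times> nat set \<Rightarrow> nat list" where
  "encode_instance = (\<lambda>(G, X).
     [card (verts G), card (arcs G)] @
     map (\<lambda>v. if v \<in> X then 1 else 0) [0..<card (verts G)] @
     concat (map (\<lambda>e. [tail G e, head G e]) [0..<card (arcs G)]))"

end

theory Submission
  imports Defs
begin

text \<open>
  For the characterization, call a vertex set \<open>W\<close> self-supporting if each vertex of \<open>W\<close> in \<open>X\<close>
  has at least one arc into \<open>W\<close>, and each other vertex of \<open>W\<close> at least two. These are the vertex
  sets of the induced subgraphs in the statement
  (\<open>dense_induced_subgraph_iff_self_supporting\<close>).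

  A nonempty self-supporting set excludes a partition: an in-branching with roots \<open>X\<close> takes at most
  one arc from each vertex outside \<open>X\<close> and none from a vertex of \<open>X\<close>, so in the other part each
  vertex of \<open>W\<close> keeps an arc into \<open>W\<close>, and this part contains a cycle
  (\<open>no_self_supporting_if_partition\<close>). Conversely, if no nonempty set is self-supporting, then the
  vertices can be removed one by one such that, at its removal, a vertex of \<open>X\<close> has no arc and any
  other vertex at most one arc to the remaining vertices. The arcs from earlier to later vertices
  are an in-branching with roots \<open>X\<close>, and the arcs from later to earlier vertices are acyclic
  (\<open>partition_if_no_self_supporting\<close>).

  For the algorithm, all vertices without sufficient support are removed simultaneously, round
  after round. The remaining sets decrease to the largest self-supporting set, which is reached
  after at most \<open>n\<close> rounds, for \<open>n\<close> vertices. So a partition exists if and only if no vertex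
  survives \<open>n\<close> rounds (\<open>survivors_empty_iff\<close>). Each round takes a pass through the vertices and
  one through the arcs. This is carried out by a concrete random access machine program, which is
  verified with a calculus of triples for sequential composition, straight-line code and counting
  loops (\<open>elimination_code_correct\<close>). All numbers in the memory stay linear in the input size, so
  the logarithmic cost of an instruction may be bounded crudely by its operands themselves instead
  of their binary length.
\<close>

section \<open>Self-supporting vertex sets\<close>

text \<open>
  The vertices with at least two arcs into \<open>A\<close>, where membership in \<open>X\<close> counts for one arc. The
  vertex set of an induced subgraph as in the characterization is exactly a nonempty post-fixed point
  \<open>W \<subseteq> supported G X W\<close> of this operator; such a set is called self-supporting.
\<close>

definition supported :: "('a, 'b) pre_digraph \<Rightarrow> 'a set \<Rightarrow> 'a set \<Rightarrow> 'a set" where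
  "supported G X A = {v \<in> verts G.
     2 \<le> of_bool (v \<in> X) + card {e \<in> arcs G. tail G e = v \<and> head G e \<in> A}}"

lemma supported_subset_verts: "supported G X A \<subseteq> verts G"
  by (auto simp: supported_def)

lemma supported_mono:
  assumes "finite (arcs G)" "A \<subseteq> B"
  shows "supported G X A \<subseteq> supported G X B"
proof -
  have "card {e \<in> arcs G. tail G e = v \<and> head G e \<in> A}
      \<le> card {e \<in> arcs G. tail G e = v \<and> head G e \<in> B}" for v
    using assms by (intro card_mono) auto
  then show ?thesis
    unfolding supported_def using order_trans by fastforce
qed

lemma dense_induced_subgraph_iff_self_supporting:
  fixes G :: "('a, 'b) pre_digraph"
  assumes "fin_digraph G"
  shows "(\<exists>H. induced_subgraph H G \<and> verts H \<noteq> {} \<and>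
            (\<forall>v \<in> verts H \<inter> X. out_degree H v \<ge> 1) \<and>
            (\<forall>v \<in> verts H - X. out_degree H v \<ge> 2)) \<longleftrightarrow>
         (\<exists>W. W \<noteq> {} \<and> W \<subseteq> supported G X W)"
proof
  interpret fin_digraph G by fact
  {
    assume "\<exists>H. induced_subgraph H G \<and> verts H \<noteq> {} \<and>
            (\<forall>v \<in> verts H \<inter> X. out_degree H v \<ge> 1) \<and>
            (\<forall>v \<in> verts H - X. out_degree H v \<ge> 2)"
    then obtain H where H: "induced_subgraph H G" "verts H \<noteq> {}"
      and dX: "\<And>v. v \<in> verts H \<Longrightarrow> v \<in> X \<Longrightarrow> out_degree H v \<ge> 1"
      and dn: "\<And>v. v \<in> verts H \<Longrightarrow> v \<notin> X \<Longrightarrow> out_degree H v \<ge> 2"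
      by auto
    have tl: "tail H = tail G" and sub: "verts H \<subseteq> verts G"
      using H(1) by (auto simp: induced_subgraph_def subgraph_def compatible_def)
    have "out_arcs H v = {e \<in> arcs G. tail G e = v \<and> head G e \<in> verts H}" if "v \<in> verts H" for v
      using H(1) that by (auto simp: out_arcs_def tl induced_subgraph_def)
    then have "verts H \<subseteq> supported G X (verts H)"
      using dX dn sub by (fastforce simp: supported_def out_degree_def)
    then show "\<exists>W. W \<noteq> {} \<and> W \<subseteq> supported G X W"
      using H(2) by blast
  }
  assume "\<exists>W. W \<noteq> {} \<and> W \<subseteq> supported G X W"
  then obtain W where W: "W \<noteq> {}" "W \<subseteq> supported G X W" by blast
  then have WV: "W \<subseteq> verts G" using supported_subset_verts by fastforce
  have deg: "out_degree (G \<restriction> W) v = card {e \<in> arcs G. tail G e = v \<and> head G e \<in> W}"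
    if "v \<in> W" for v
    using that unfolding out_degree_def out_arcs_def
    by (intro arg_cong[where f = card]) (auto simp: induce_subgraph_def)
  have "out_degree (G \<restriction> W) v + of_bool (v \<in> X) \<ge> 2" if "v \<in> W" for v
    using W(2) deg that by (auto simp: supported_def)
  then have "\<forall>v \<in> W \<inter> X. out_degree (G \<restriction> W) v \<ge> 1" "\<forall>v \<in> W - X. out_degree (G \<restriction> W) v \<ge> 2"
    by fastforce+
  then show "\<exists>H. induced_subgraph H G \<and> verts H \<noteq> {} \<and>
            (\<forall>v \<in> verts H \<inter> X. out_degree H v \<ge> 1) \<and>
            (\<forall>v \<in> verts H - X. out_degree H v \<ge> 2)"
    using W(1) induced_induce[OF WV] by (intro exI[of _ "G \<restriction> W"]) auto
qed


section \<open>Acyclic arc sets\<close>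

lemma (in wf_digraph) wf_digraph_arcs_subset: "S \<subseteq> arcs G \<Longrightarrow> wf_digraph (G\<lparr>arcs := S\<rparr>)"
  by unfold_locales auto

lemma (in wf_digraph) acyclic_arcs_by_ranking:
  fixes f :: "'a \<Rightarrow> nat"
  assumes "S \<subseteq> arcs G" and dec: "\<And>e. e \<in> S \<Longrightarrow> f (head G e) < f (tail G e)"
  shows "acyclic_arcs G S"
proof -
  interpret S: wf_digraph "G\<lparr>arcs := S\<rparr>" by (rule wf_digraph_arcs_subset) fact
  have "f v \<le> f u \<and> (p \<noteq> [] \<longrightarrow> f v < f u)" if "S.cas u p v" "set p \<subseteq> S" for u p v
    using that
  proof (induction p arbitrary: u)
    case (Cons e p)
    then show ?case using dec[of e] by fastforce
  qed simp
  then have "\<not> S.cycle p" for p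
    unfolding S.cycle_def S.awalk_def by fastforce
  then show ?thesis using assms by (auto simp: acyclic_arcs_def)
qed

lemma (in wf_digraph) not_acyclic_arcs_if_no_sink:
  assumes "S \<subseteq> arcs G" "finite S" "W \<noteq> {}"
    and next_arc: "\<And>v. v \<in> W \<Longrightarrow> \<exists>e \<in> S. tail G e = v \<and> head G e \<in> W"
  shows "\<not> acyclic_arcs G S"
proof -
  interpret S: wf_digraph "G\<lparr>arcs := S\<rparr>" by (rule wf_digraph_arcs_subset) fact
  define R where "R = (\<lambda>e. (tail G e, head G e)) ` S"
  have "\<not> acyclic R"
  proof
    assume "acyclic R"
    then have "wf (R\<inverse>)"
      using \<open>finite S\<close> by (intro finite_acyclic_wf_converse) (auto simp: R_def)
    then obtain z where "z \<in> W" "\<And>y. (y, z) \<in> R\<inverse> \<Longrightarrow> y \<notin> W"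
      using \<open>W \<noteq> {}\<close> wfE_min' by metis
    then show False using next_arc[of z] by (auto simp: R_def)
  qed
  then obtain x where "(x, x) \<in> R\<^sup>+" by (auto simp: acyclic_def)
  moreover have "R = arcs_ends (G\<lparr>arcs := S\<rparr>)"
    by (auto simp: R_def arcs_ends_def arc_to_ends_def)
  ultimately have "\<exists>p. S.awalk x p x \<and> p \<noteq> []"
    using S.reachable1_awalk by metis
  then have "\<exists>p. S.closed_w p" by (auto simp: S.closed_w_def)
  then show ?thesis
    using S.closed_w_imp_cycle by (auto simp: acyclic_arcs_def)
qed


section \<open>The characterization\<close>

text \<open>
  In a self-supporting set, the in-branching accounts for at most one arc leaving a vertex outside
  \<open>X\<close> and for none leaving a vertex of \<open>X\<close>. So every vertex keeps an arc of the acyclic part that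
  stays in the set, which is impossible unless the set is empty.
\<close>

lemma no_self_supporting_if_partition:
  fixes G :: "('a, 'b) pre_digraph"
  assumes "fin_digraph G" "has_acyclic_in_branching_partition G X" "W \<subseteq> supported G X W"
  shows "W = {}"
proof (rule ccontr)
  assume "W \<noteq> {}"
  interpret fin_digraph G by fact
  obtain F B where FB: "F \<union> B = arcs G" "F \<inter> B = {}" "acyclic_arcs G F"
    "in_branching G B" "X \<subseteq> branching_roots G B"
    using assms(2) by (auto simp: has_acyclic_in_branching_partition_def)
  have "\<exists>e \<in> F. tail G e = v \<and> head G e \<in> W" if "v \<in> W" for v
  proof (rule ccontr)
    assume none: "\<not> ?thesis"
    have "v \<in> supported G X W" using assms(3) that by blast
    then have v: "v \<in> verts G"
      and deg: "2 \<le> of_bool (v \<in> X) + card {e \<in> arcs G. tail G e = v \<and> head G e \<in> W}"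
      by (auto simp: supported_def)
    have "{e \<in> arcs G. tail G e = v \<and> head G e \<in> W} \<subseteq> out_arcs (G\<lparr>arcs := B\<rparr>) v"
      using FB(1) none by auto
    moreover have fin: "finite (out_arcs (G\<lparr>arcs := B\<rparr>) v)"
      by (rule finite_subset[OF _ finite_arcs]) (use FB(1) in \<open>auto simp: out_arcs_def\<close>)
    ultimately have "2 \<le> of_bool (v \<in> X) + card (out_arcs (G\<lparr>arcs := B\<rparr>) v)"
      using deg card_mono by (meson add_left_mono order_trans)
    moreover have "card (out_arcs (G\<lparr>arcs := B\<rparr>) v) \<le> 1"
      using FB(4) v by (auto simp: in_branching_def out_degree_def)
    moreover have "out_arcs (G\<lparr>arcs := B\<rparr>) v = {}" if "v \<in> X"
      using FB(5) that by (auto simp: branching_roots_def)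
    ultimately show False by (cases "v \<in> X") auto
  qed
  moreover have "F \<subseteq> arcs G" using FB(1) by blast
  moreover have "finite F" using FB(1) finite_arcs by (metis finite_Un)
  ultimately have "\<not> acyclic_arcs G F"
    using \<open>W \<noteq> {}\<close> by (intro not_acyclic_arcs_if_no_sink)
  then show False using FB(3) by contradiction
qed

text \<open>
  Vertices are eliminated from \<open>V\<close> by increasing \<open>f\<close>. At its turn, a vertex of \<open>X\<close> has no
  arc, and any other vertex has at most one arc, to the vertices that are still present.
\<close>

definition elimination_order ::
    "('a, 'b) pre_digraph \<Rightarrow> 'a set \<Rightarrow> 'a set \<Rightarrow> ('a \<Rightarrow> nat) \<Rightarrow> bool" where
  "elimination_order G X V f \<longleftrightarrow> inj_on f V \<and> (\<forall>v \<in> V.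
    of_bool (v \<in> X) + card {e \<in> arcs G. tail G e = v \<and> head G e \<in> V \<and> f v < f (head G e)} \<le> 1)"

lemma elimination_order_extend:
  assumes "finite (arcs G)" "V \<subseteq> verts G" "v \<in> V" "v \<notin> supported G X V"
    and f: "elimination_order G X (V - {v}) f"
  shows "elimination_order G X V (\<lambda>u. if u = v then 0 else Suc (f u))"
proof -
  define g where "g u = (if u = v then 0 else Suc (f u))" for u
  have "inj_on g V" using f by (auto simp: g_def inj_on_def elimination_order_def)
  moreover have "of_bool (u \<in> X) +
      card {e \<in> arcs G. tail G e = u \<and> head G e \<in> V \<and> g u < g (head G e)} \<le> 1"
    if "u \<in> V" for u
  proof (cases "u = v")
    case True
    have "card {e \<in> arcs G. tail G e = v \<and> head G e \<in> V \<and> g v < g (head G e)}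
        \<le> card {e \<in> arcs G. tail G e = v \<and> head G e \<in> V}"
      using assms(1) by (intro card_mono) auto
    moreover have "of_bool (v \<in> X) + card {e \<in> arcs G. tail G e = v \<and> head G e \<in> V} < 2"
      using assms(2-4) unfolding supported_def by (simp add: subset_iff)
    ultimately show ?thesis unfolding True by linarith
  next
    case False
    then have "{e \<in> arcs G. tail G e = u \<and> head G e \<in> V \<and> g u < g (head G e)} =
      {e \<in> arcs G. tail G e = u \<and> head G e \<in> V - {v} \<and> f u < f (head G e)}"
      by (auto simp: g_def)
    then show ?thesis using f False that by (simp add: elimination_order_def)
  qed
  ultimately show ?thesis unfolding elimination_order_def g_def by simp
qed

lemma elimination_order_exists:
  assumes "finite (arcs G)" and none: "\<And>W. W \<subseteq> supported G X W \<Longrightarrow> W = {}"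
    and "finite V" "V \<subseteq> verts G"
  shows "\<exists>f. elimination_order G X V f"
  using assms(3,4)
proof (induction V rule: finite_psubset_induct)
  case (psubset V)
  show ?case
  proof (cases "V = {}")
    case True
    then show ?thesis by (simp add: elimination_order_def)
  next
    case False
    then have "\<not> V \<subseteq> supported G X V" using none by metis
    then obtain v where v: "v \<in> V" "v \<notin> supported G X V" by auto
    have "V - {v} \<subset> V" "V - {v} \<subseteq> verts G" using v(1) psubset.prems by auto
    from psubset.IH[OF this] obtain f where "elimination_order G X (V - {v}) f" ..
    then show ?thesis
      using elimination_order_extend[OF assms(1) psubset.prems v] by metis
  qed
qed

text \<open>
  Given an elimination order, the arcs against the order form the acyclic part and the arcs along it
  form the in-branching.
\<close>

lemma partition_if_no_self_supporting:
  fixes G :: "('a, 'b) pre_digraph"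
  assumes "fin_digraph G" "loopfree_digraph G" "X \<subseteq> verts G"
    and "\<And>W. W \<subseteq> supported G X W \<Longrightarrow> W = {}"
  shows "has_acyclic_in_branching_partition G X"
proof -
  interpret fin_digraph G by fact
  interpret loopfree_digraph G by fact
  obtain f where f: "elimination_order G X (verts G) f"
    using elimination_order_exists[OF finite_arcs assms(4) finite_verts] by auto
  then have inj: "inj_on f (verts G)" by (simp add: elimination_order_def)
  define F where "F = {e \<in> arcs G. f (head G e) < f (tail G e)}"
  define B where "B = {e \<in> arcs G. f (tail G e) < f (head G e)}"
  \<comment> \<open>No arc escapes both classes: \<open>f\<close> is injective and there are no loops.\<close>
  have "f (head G e) \<noteq> f (tail G e)" if "e \<in> arcs G" for e
    using that inj no_loops[of e] by (auto dest: inj_onD)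
  then have part: "F \<union> B = arcs G" "F \<inter> B = {}"
    by (auto simp: F_def B_def neq_iff)
  have acF: "acyclic_arcs G F"
    by (rule acyclic_arcs_by_ranking[of _ f]) (auto simp: F_def)
  have acB: "acyclic_arcs G B"
  \<comment> \<open>The maximum turns the order around, since the ranking has to decrease along arcs.\<close>
  proof (rule acyclic_arcs_by_ranking)
    fix e assume e: "e \<in> B"
    have "f u \<le> Max (f ` verts G)" if "u \<in> verts G" for u
      using that by simp
    with e show "Max (f ` verts G) - f (head G e) < Max (f ` verts G) - f (tail G e)"
      by (fastforce simp: B_def intro: diff_less_mono2 less_le_trans)
  qed (auto simp: B_def)
  have out: "of_bool (v \<in> X) + card (out_arcs (G\<lparr>arcs := B\<rparr>) v) \<le> 1"
    if "v \<in> verts G" for v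
  proof -
    have "out_arcs (G\<lparr>arcs := B\<rparr>) v =
        {e \<in> arcs G. tail G e = v \<and> head G e \<in> verts G \<and> f v < f (head G e)}"
      by (auto simp: B_def out_arcs_def)
    then show ?thesis using f that by (simp add: elimination_order_def)
  qed
  then have deg: "card (out_arcs (G\<lparr>arcs := B\<rparr>) v) \<le> 1" if "v \<in> verts G" for v
    using that add_leD2 by blast
  have roots: "X \<subseteq> branching_roots G B"
  proof
    fix v assume v: "v \<in> X"
    moreover have "finite (out_arcs (G\<lparr>arcs := B\<rparr>) v)"
      by (rule finite_subset[OF _ finite_arcs]) (auto simp: out_arcs_def B_def)
    ultimately show "v \<in> branching_roots G B"
      using out[of v] assms(3) by (auto simp: branching_roots_def)
  qed
  show ?thesis
    unfolding has_acyclic_in_branching_partition_def in_branching_def out_degree_def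
    by (rule exI[of _ F], rule exI[of _ B]) (intro conjI ballI part acF acB roots deg)
qed

lemma partition_iff_no_self_supporting:
  assumes "fin_digraph G" "loopfree_digraph G" "X \<subseteq> verts G"
  shows "has_acyclic_in_branching_partition G X \<longleftrightarrow>
    \<not> (\<exists>W. W \<noteq> {} \<and> W \<subseteq> supported G X W)"
proof
  assume "has_acyclic_in_branching_partition G X"
  then show "\<not> (\<exists>W. W \<noteq> {} \<and> W \<subseteq> supported G X W)"
    using no_self_supporting_if_partition[OF assms(1)] by metis
next
  assume none: "\<not> (\<exists>W. W \<noteq> {} \<and> W \<subseteq> supported G X W)"
  show "has_acyclic_in_branching_partition G X"
  proof (rule partition_if_no_self_supporting[OF assms])
    fix W assume "W \<subseteq> supported G X W"
    then show "W = {}" using none by metis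
  qed
qed


section \<open>Elimination in rounds\<close>

text \<open>
  Each round removes all unsupported vertices simultaneously. Unlike an elimination order, this
  leaves no choice open, and it only serves to decide whether a self-supporting set exists.
\<close>

primrec survivors :: "('a, 'b) pre_digraph \<Rightarrow> 'a set \<Rightarrow> nat \<Rightarrow> 'a set" where
  "survivors G X 0 = verts G"
| "survivors G X (Suc r) = supported G X (survivors G X r)"

lemma survivors_subset_verts: "survivors G X r \<subseteq> verts G"
  by (cases r) (auto simp: supported_def)

lemma survivors_decreasing:
  assumes "finite (arcs G)"
  shows "survivors G X (Suc r) \<subseteq> survivors G X r"
proof (induction r)
  case 0
  show ?case by (simp add: supported_subset_verts)
next
  case (Suc r)
  then show ?case using supported_mono[OF assms] by simp
qed

lemma survivors_stable_or_small:
  assumes "finite (arcs G)" "finite (verts G)"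
  shows "survivors G X (Suc r) = survivors G X r \<or>
    card (survivors G X r) + r \<le> card (verts G)"
proof (induction r)
  case (Suc r)
  show ?case
  proof (cases "survivors G X (Suc r) = survivors G X r")
    case False
    then have "survivors G X (Suc r) \<subset> survivors G X r"
      using survivors_decreasing[OF assms(1)] by blast
    moreover have "finite (survivors G X r)"
      using survivors_subset_verts assms(2) by (rule finite_subset)
    ultimately have "card (survivors G X (Suc r)) < card (survivors G X r)"
      by (rule psubset_card_mono[rotated])
    then show ?thesis using Suc False by linarith
  qed simp
qed simp

text \<open>
  The survivors decrease and always contain every self-supporting set. After as many rounds as there
  are vertices they are either empty or stable, and a stable set is self-supporting.
\<close>

lemma survivors_empty_iff:
  assumes "finite (arcs G)" "finite (verts G)"
  shows "survivors G X (card (verts G)) = {} \<longleftrightarrow> \<not> (\<exists>W. W \<noteq> {} \<and> W \<subseteq> supported G X W)"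
proof
  define S where "S = survivors G X (card (verts G))"
  assume "\<not> (\<exists>W. W \<noteq> {} \<and> W \<subseteq> supported G X W)"
  then have "S = {} \<or> supported G X S \<noteq> S" by (metis order_refl)
  moreover have "supported G X S = S \<or> card S = 0"
    using survivors_stable_or_small[OF assms, of X "card (verts G)"] by (auto simp: S_def)
  moreover have "finite S"
    unfolding S_def using survivors_subset_verts assms(2) by (rule finite_subset)
  ultimately have "S = {}" by auto
  then show "survivors G X (card (verts G)) = {}" by (simp add: S_def)
next
  assume empty: "survivors G X (card (verts G)) = {}"
  have "W \<subseteq> survivors G X r" if "W \<subseteq> supported G X W" for W r
  proof (induction r)
    case 0
    show ?case using that supported_subset_verts[of G X W] by simp
  next
    case (Suc r)
    then have "supported G X W \<subseteq> survivors G X (Suc r)"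
      using supported_mono[OF assms(1)] by simp
    with that show ?case by (rule subset_trans)
  qed
  then show "\<not> (\<exists>W. W \<noteq> {} \<and> W \<subseteq> supported G X W)" using empty by blast
qed

section \<open>Structured random access machine programs\<close>

text \<open>
  A piece of code is a function of the position at which it is placed, because jump targets are
  absolute. Assertions speak about the memory and the unread input.
\<close>

type_synonym ram_code = "nat \<Rightarrow> ram_instr list"
type_synonym ram_assn = "(nat \<Rightarrow> nat) \<Rightarrow> nat list \<Rightarrow> bool"

text \<open>
  Total correctness with a cost bound: wherever \<open>c\<close> is placed in a program, a run that enters it
  with \<open>P\<close> reaches the position just after it with \<open>Q\<close>, at cost at most \<open>T\<close>.
\<close>

definition triple :: "ram_assn \<Rightarrow> ram_code \<Rightarrow> nat \<Rightarrow> ram_assn \<Rightarrow> bool" where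
  "triple P c T Q \<longleftrightarrow> (\<forall>pre post s.
     pc s = length pre \<longrightarrow> P (mem s) (inp s) \<longrightarrow>
     (\<exists>t s'. t \<le> T \<and> ram_run (pre @ c (length pre) @ post) s t s' \<and>
        pc s' = length pre + length (c (length pre)) \<and> Q (mem s') (inp s')))"

lemma tripleD:
  assumes "triple P c T Q" "pc s = length pre" "P (mem s) (inp s)"
  obtains t s' where "t \<le> T" "ram_run (pre @ c (length pre) @ post) s t s'"
    "pc s' = length pre + length (c (length pre))" "Q (mem s') (inp s')"
  using assms unfolding triple_def by metis

lemma ram_run_trans:
  assumes "ram_run P s t s'" "ram_run P s' t' s''"
  shows "ram_run P s (t + t') s''"
  using assms by (induction rule: ram_run.induct) (auto simp: add.assoc intro: ram_run.step)

lemma triple_conseq: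
  assumes "triple P' c T' Q'" "\<And>m w. P m w \<Longrightarrow> P' m w" "\<And>m w. Q' m w \<Longrightarrow> Q m w" "T' \<le> T"
  shows "triple P c T Q"
  unfolding triple_def
proof (intro allI impI)
  fix pre post :: "ram_instr list" and s :: ram_config
  assume s: "pc s = length pre" "P (mem s) (inp s)"
  obtain t s' where "t \<le> T'" "ram_run (pre @ c (length pre) @ post) s t s'"
    "pc s' = length pre + length (c (length pre))" "Q' (mem s') (inp s')"
    using tripleD[OF assms(1) s(1) assms(2)[OF s(2)]] .
  then show "\<exists>t s'. t \<le> T \<and> ram_run (pre @ c (length pre) @ post) s t s' \<and>
      pc s' = length pre + length (c (length pre)) \<and> Q (mem s') (inp s')"
    using assms(3,4) by (meson order_trans)
qed

definition seq_code :: "ram_code \<Rightarrow> ram_code \<Rightarrow> ram_code" (infixr ";;" 60) where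
  "(c ;; d) l = c l @ d (l + length (c l))"

lemma triple_seq:
  assumes "triple P c T Q" "triple Q d T' R"
  shows "triple P (c ;; d) (T + T') R"
  unfolding triple_def
proof (intro allI impI)
  fix pre post :: "ram_instr list" and s :: ram_config
  let ?c = "c (length pre)" and ?d = "d (length pre + length (c (length pre)))"
  let ?P = "pre @ (c ;; d) (length pre) @ post"
  assume s: "pc s = length pre" "P (mem s) (inp s)"
  obtain t1 s1 where 1: "t1 \<le> T" "ram_run (pre @ ?c @ (?d @ post)) s t1 s1"
    "pc s1 = length (pre @ ?c)" "Q (mem s1) (inp s1)"
    using tripleD[OF assms(1) s] by (metis length_append)
  obtain t2 s2 where 2: "t2 \<le> T'" "ram_run ((pre @ ?c) @ ?d @ post) s1 t2 s2"
    "pc s2 = length (pre @ ?c) + length ?d" "R (mem s2) (inp s2)"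
    using tripleD[OF assms(2) 1(3,4)] by (metis length_append)
  have "ram_run ?P s (t1 + t2) s2"
    using ram_run_trans 1(2) 2(2) by (simp add: seq_code_def)
  then show "\<exists>t s'. t \<le> T + T' \<and> ram_run ?P s t s' \<and>
      pc s' = length pre + length ((c ;; d) (length pre)) \<and> R (mem s') (inp s')"
    using 1(1) 2(1,3,4)
    by (intro exI[of _ "t1 + t2"] exI[of _ s2]) (simp add: seq_code_def add_mono)
qed


subsection \<open>Straight-line code\<close>

definition bounded_by :: "nat \<Rightarrow> (nat \<Rightarrow> nat) \<Rightarrow> bool" where
  "bounded_by M \<mu> \<longleftrightarrow> (\<forall>a. \<mu> a \<le> M)"

lemma bounded_byD: "bounded_by M \<mu> \<Longrightarrow> \<mu> a \<le> M"
  by (simp add: bounded_by_def)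

lemma bounded_by_upd: "bounded_by M \<mu> \<Longrightarrow> x \<le> M \<Longrightarrow> bounded_by M (\<mu>(a := x))"
  by (simp add: bounded_by_def)

text \<open>Instructions other than jumps, with constants at most \<open>M\<close>.\<close>

fun straight :: "nat \<Rightarrow> ram_instr \<Rightarrow> bool" where
  "straight M (Const i c) \<longleftrightarrow> c \<le> M"
| "straight M (JumpPos i l) \<longleftrightarrow> False"
| "straight M _ \<longleftrightarrow> True"

lemma bit_size_le: "bit_size k \<le> Suc k"
proof -
  have "floor_log k \<le> k"
    using floor_log_le_iff[of k "2 ^ k"] less_exp[of k] by simp
  then show ?thesis by (simp add: bit_size_def)
qed

lemma straight_exec:
  assumes "straight M x" "bounded_by M (mem s)" "\<forall>k \<in> set (inp s). k \<le> M"
  shows "pc (ram_exec x s) = Suc (pc s)"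
    and "bounded_by (2 * M) (mem (ram_exec x s))"
    and "\<forall>k \<in> set (inp (ram_exec x s)). k \<le> 2 * M"
    and "ram_cost x s \<le> 2 * (M + 1)"
proof -
  have le: "mem s a \<le> M" for a using assms(2) by (rule bounded_byD)
  have in_le: "next_input (inp s) \<le> M" using assms(3) by (cases "inp s") auto
  have bit: "bit_size k \<le> M + 1" if "k \<le> M" for k
    using bit_size_le[of k] that by linarith
  show "pc (ram_exec x s) = Suc (pc s)" using assms(1) by (cases x) auto
  have "mem s a \<le> 2 * M" for a using le[of a] by linarith
  moreover have "mem s a + mem s b \<le> 2 * M" "mem s a - mem s b \<le> 2 * M" for a b
    using le[of a] le[of b] by linarith+
  ultimately show "bounded_by (2 * M) (mem (ram_exec x s))"
    using assms(1) in_le by (cases x) (auto simp: bounded_by_def)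
  have "k \<le> 2 * M" if "k \<in> set (inp s)" for k using assms(3) that by fastforce
  then show "\<forall>k \<in> set (inp (ram_exec x s)). k \<le> 2 * M"
    by (cases x; cases "inp s") auto
  have bit_mem: "bit_size (mem s a) \<le> M + 1" for a using bit[OF le] .
  have "bit_size (mem s a) + bit_size (mem s b) \<le> 2 * (M + 1)" for a b
    using add_mono[OF bit_mem[of a] bit_mem[of b]] by (simp add: mult_2)
  moreover have "bit_size (mem s a) \<le> 2 * (M + 1)" for a
    using bit_mem[of a] by simp
  moreover have "bit_size k \<le> 2 * (M + 1)" if "k \<le> M" for k
    using bit[OF that] by simp
  ultimately show "ram_cost x s \<le> 2 * (M + 1)"
    using assms(1) in_le by (cases x) auto
qed

text \<open>
  An instruction at most doubles the bound \<open>M\<close> on the numbers in memory and input, and it costs at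
  most \<open>2 * (M + 1)\<close>. Hence this bounds the cost of \<open>k\<close> instructions in a row. The factor is
  exponential in \<open>k\<close>, which is harmless since \<open>k\<close> is the length of a fixed piece of code.
\<close>

definition block_time :: "nat \<Rightarrow> nat \<Rightarrow> nat" where
  "block_time M k = k * 2 ^ Suc k * (M + 1)"

lemma straight_run:
  assumes "\<forall>x \<in> set xs. straight M x" "bounded_by M (mem s)" "\<forall>k \<in> set (inp s). k \<le> M"
    and "pc s = length pre"
  shows "\<exists>t \<le> block_time M (length xs).
    ram_run (pre @ xs @ post) s t (fold ram_exec xs s) \<and>
    pc (fold ram_exec xs s) = length pre + length xs"
  using assms
proof (induction xs arbitrary: M s pre)
  case Nil
  then show ?case by (auto intro: ram_run.refl)
next
  case (Cons x xs)
  let ?s = "ram_exec x s"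
  have x: "straight M x" using Cons.prems(1) by simp
  note ex = straight_exec[OF x Cons.prems(2,3)]
  have "straight (2 * M) y" if "straight M y" for y using that by (cases y) auto
  then have "\<forall>y \<in> set xs. straight (2 * M) y" using Cons.prems(1) by simp
  from Cons.IH[OF this ex(2,3), of "pre @ [x]"] obtain t where
    t: "t \<le> block_time (2 * M) (length xs)"
    "ram_run (pre @ (x # xs) @ post) ?s t (fold ram_exec xs ?s)"
    "pc (fold ram_exec xs ?s) = length pre + length (x # xs)"
    using ex(1) Cons.prems(4) by auto
  have "ram_run (pre @ (x # xs) @ post) s (ram_cost x s + t) (fold ram_exec xs ?s)"
    using ram_run.step[of s "pre @ (x # xs) @ post"] t(2) Cons.prems(4) by (simp add: nth_append)
  moreover have "ram_cost x s + t \<le> block_time M (length (x # xs))"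
  proof -
    have "block_time (2 * M) (length xs) \<le> length xs * 2 ^ Suc (length xs) * (2 * (M + 1))"
      unfolding block_time_def by (intro mult_le_mono) auto
    moreover have "2 * (M + 1) \<le> 2 ^ Suc (length (x # xs)) * (M + 1)"
      by (intro mult_le_mono) auto
    ultimately have "ram_cost x s + t \<le> 2 ^ Suc (length (x # xs)) * (M + 1)
        + length xs * 2 ^ Suc (length xs) * (2 * (M + 1))"
      using t(1) ex(4) by linarith
    also have "\<dots> = block_time M (length (x # xs))"
      by (simp add: block_time_def algebra_simps)
    finally show ?thesis .
  qed
  ultimately show ?case using t(3) by auto
qed

text \<open>
  Only the precondition has to provide the bound \<open>M\<close>; this also covers the cost of everything
  computed inside the block.
\<close>

lemma triple_block:
  assumes "\<forall>x \<in> set xs. straight M x"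
    and "\<And>s :: ram_config. P (mem s) (inp s) \<Longrightarrow> bounded_by M (mem s)"
    and "\<And>(s :: ram_config) k. P (mem s) (inp s) \<Longrightarrow> k \<in> set (inp s) \<Longrightarrow> k \<le> M"
    and "\<And>s :: ram_config. P (mem s) (inp s) \<Longrightarrow> Q (mem (fold ram_exec xs s)) (inp (fold ram_exec xs s))"
  shows "triple P (\<lambda>_. xs) (block_time M (length xs)) Q"
  unfolding triple_def
proof (intro allI impI)
  fix pre post :: "ram_instr list" and s :: ram_config
  assume s: "pc s = length pre" "P (mem s) (inp s)"
  have "\<forall>k \<in> set (inp s). k \<le> M" using assms(3) s(2) by blast
  from straight_run[OF assms(1) assms(2)[OF s(2)] this s(1), of post] assms(4)[OF s(2)]
  show "\<exists>t s'. t \<le> block_time M (length xs) \<and> ram_run (pre @ xs @ post) s t s' \<and>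
      pc s' = length pre + length xs \<and> Q (mem s') (inp s')"
    by auto
qed


subsection \<open>Counting loops\<close>

text \<open>
  The code \<open>c\<close> is repeated as long as register \<open>i\<close> is positive; \<open>c\<close> itself has to decrement it.
  The first jump goes to the test at the end, and it is unconditional provided that register 1
  holds 1.
\<close>

definition loop_code :: "nat \<Rightarrow> ram_code \<Rightarrow> ram_code" where
  "loop_code i c l =
     JumpPos 1 (Suc l + length (c (Suc l))) # c (Suc l) @ [JumpPos i (Suc l)]"

text \<open>
  One initial jump, \<open>N + 1\<close> tests and \<open>N\<close> passes of cost \<open>T\<close>.
\<close>

definition loop_time :: "nat \<Rightarrow> nat \<Rightarrow> nat \<Rightarrow> nat" where
  "loop_time M N T = (N + 2) * (M + 1) + N * T"

lemma triple_loop: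
  assumes body: "\<And>k. k < N \<Longrightarrow> triple (\<lambda>m w. I k m w \<and> m i = N - k) c T
      (\<lambda>m w. I (Suc k) m w \<and> m i = N - Suc k)"
    and one: "\<And>m w. I 0 m w \<Longrightarrow> m 1 = 1"
    and bdd: "\<And>k m w. I k m w \<Longrightarrow> bounded_by M m"
  shows "triple (\<lambda>m w. I 0 m w \<and> m i = N) (loop_code i c) (loop_time M N T) (\<lambda>m w. I N m w)"
  unfolding triple_def
proof (intro allI impI)
  fix pre post :: "ram_instr list" and s :: ram_config
  define l where "l = length pre"
  define P where "P = pre @ loop_code i c l @ post"
  define e where "e = Suc l + length (c (Suc l))"
  assume s: "pc s = length pre" "I 0 (mem s) (inp s) \<and> mem s i = N"
  have P_body: "P = (pre @ [JumpPos 1 e]) @ c (Suc l) @ JumpPos i (Suc l) # post"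
    by (simp add: P_def e_def loop_code_def)
  have at_l: "P ! l = JumpPos 1 e" and at_e: "P ! e = JumpPos i (Suc l)"
    and len: "l < length P" "e < length P"
    by (simp_all add: P_body e_def l_def nth_append)
  have bit: "bit_size (mem s' j) \<le> M + 1" if "I k (mem s') (inp s')" for k s' j
    using bit_size_le[of "mem s' j"] bounded_byD[OF bdd[OF that], of j] by linarith
  \<comment> \<open>Starting from the test, by induction on the number \<open>j\<close> of remaining passes.\<close>
  have loop: "\<exists>t s''. t \<le> (j + 1) * (M + 1) + j * T \<and> ram_run P s' t s'' \<and> pc s'' = Suc e \<and>
      I N (mem s'') (inp s'')"
    if "pc s' = e" "I (N - j) (mem s') (inp s')" "mem s' i = j" "j \<le> N" for j s'
    using that
  proof (induction j arbitrary: s')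
    case 0
    have "ram_run P s' (ram_cost (P ! pc s') s' + 0) (ram_exec (P ! pc s') s')"
      using 0 len by (intro ram_run.step ram_run.refl) simp
    then have "ram_run P s' (bit_size (mem s' i)) (s'\<lparr>pc := Suc e\<rparr>)"
      using 0 by (simp add: at_e)
    then show ?case using 0 bit[of N s' i]
      by (intro exI[of _ "bit_size (mem s' i)"] exI[of _ "s'\<lparr>pc := Suc e\<rparr>"]) simp
  next
    case (Suc j)
    let ?s = "s'\<lparr>pc := Suc l\<rparr>" and ?b = "bit_size (mem s' i)"
    have k: "N - Suc j < N" "N - (N - Suc j) = Suc j" "Suc (N - Suc j) = N - j" "N - (N - j) = j"
      using Suc.prems(4) by auto
    let ?pre = "pre @ [JumpPos 1 e]"
    have "pc ?s = length ?pre" by (simp add: l_def)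
    moreover have "I (N - Suc j) (mem ?s) (inp ?s) \<and> mem ?s i = N - (N - Suc j)"
      using Suc.prems k by simp
    ultimately obtain t1 s1 where "t1 \<le> T"
      "ram_run (?pre @ c (length ?pre) @ JumpPos i (Suc l) # post) ?s t1 s1"
      "pc s1 = length ?pre + length (c (length ?pre))"
      "I (Suc (N - Suc j)) (mem s1) (inp s1) \<and> mem s1 i = N - Suc (N - Suc j)"
      by (rule tripleD[OF body[OF k(1)]])
    then have 1: "t1 \<le> T" "ram_run P ?s t1 s1" "pc s1 = e"
      "I (N - j) (mem s1) (inp s1)" "mem s1 i = j"
      unfolding k(3,4) by (simp_all add: P_body e_def l_def)
    obtain t2 s2 where 2: "t2 \<le> (j + 1) * (M + 1) + j * T" "ram_run P s1 t2 s2"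
      "pc s2 = Suc e" "I N (mem s2) (inp s2)"
      using Suc.IH[OF 1(3,4,5)] Suc.prems(4) by auto
    have "ram_run P s' (?b + (t1 + t2)) s2"
      using ram_run.step[of s' P "t1 + t2" s2] ram_run_trans[OF 1(2) 2(2)] Suc.prems len
      by (simp add: at_e)
    moreover have "?b + (t1 + t2) \<le> (Suc j + 1) * (M + 1) + Suc j * T"
      using 1(1) 2(1) bit[OF Suc.prems(2), of i] by simp
    ultimately show ?case using 2(3,4) by blast
  qed
  let ?s = "s\<lparr>pc := e\<rparr>" and ?b = "bit_size (mem s 1)"
  have "mem s 1 = 1" using s(2) one by blast
  have "\<exists>t s''. t \<le> (N + 1) * (M + 1) + N * T \<and> ram_run P ?s t s'' \<and> pc s'' = Suc e \<and>
      I N (mem s'') (inp s'')"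
    by (rule loop) (use s in auto)
  then obtain t s'' where t: "t \<le> (N + 1) * (M + 1) + N * T" "ram_run P ?s t s''"
    "pc s'' = Suc e" "I N (mem s'') (inp s'')" by blast
  have "ram_run P s (?b + t) s''"
    using ram_run.step[of s P t s''] t(2) len s(1) \<open>mem s 1 = 1\<close> by (simp add: at_l l_def[symmetric])
  moreover have "?b + t \<le> loop_time M N T"
    using t(1) bit[of 0 s 1] s(2) by (simp add: loop_time_def)
  moreover have "Suc e = length pre + length (loop_code i c (length pre))"
    by (simp add: e_def loop_code_def l_def)
  ultimately show "\<exists>t s'. t \<le> loop_time M N T \<and>
      ram_run (pre @ loop_code i c (length pre) @ post) s t s' \<and>
      pc s' = length pre + length (loop_code i c (length pre)) \<and> I N (mem s') (inp s')"
    using t(3,4) unfolding P_def l_def by auto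
qed

section \<open>A program for the elimination in rounds\<close>

text \<open>
  With \<open>n\<close> vertices and \<open>m\<close> arcs, the memory is used as follows.

  \<^item> Register 0 holds the output. Registers 1, 14 and 15 hold the constants 1, 2 and 0,
    registers 2 and 3 hold \<open>n\<close> and \<open>m\<close>, registers 4 and 5 hold the start addresses of the
    two tables below. Registers 7 and 8 count the remaining rounds and the remaining passes of the
    inner loop; registers 9 to 12 are used for pointers and intermediate values.
  \<^item> From address 16 on, there are the \<open>n\<close> flags for membership in \<open>X\<close> and the \<open>m\<close> pairs of
    tail and head, in the order in which they are read.
  \<^item> The liveness table of length \<open>n\<close> follows. It tells which vertices survive at the beginning of
    the current round.
  \<^item> The slack table of length \<open>n\<close> comes last. It tells how many arcs to surviving vertices are
    still missing for a vertex to be supported.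

  Since subtraction is truncated, a vertex is supported exactly when its slack is reduced to 0. As
  the memory is initially 0, all vertices survive at the beginning of the first round.

  A round computes the liveness table from the slack table, while resetting the slack to its
  initial value 2 or, in \<open>X\<close>, 1. Then, for every arc, the liveness of its head is subtracted from
  the slack of its tail. The output is reset to 1 in every round and truncated to 0 by any vertex
  that survives at the beginning of this round. There are \<open>n + 1\<close> rounds, so that the last one
  outputs whether no vertex survives after \<open>n\<close> rounds.
\<close>

definition init_block :: "ram_instr list" where
  "init_block = [Const 1 1, Read 2, Read 3, Add 8 2 3, Add 8 8 3, Const 9 16]"

definition read_block :: "ram_instr list" where
  "read_block = [Read 10, Store 9 10, Add 9 9 1, Sub 8 8 1]"

definition setup_block :: "ram_instr list" where
  "setup_block = [Add 4 9 15, Add 5 4 2, Add 7 2 1, Const 14 2]"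

definition round_block :: "ram_instr list" where
  "round_block = [Const 0 1, Const 9 16, Add 10 4 15, Add 11 5 15, Add 8 2 15]"

definition vertex_block :: "ram_instr list" where
  "vertex_block =
     [Load 12 11, Sub 12 1 12, Store 10 12, Sub 0 0 12, Load 12 9, Sub 12 14 12, Store 11 12,
      Add 9 9 1, Add 10 10 1, Add 11 11 1, Sub 8 8 1]"

definition arcs_block :: "ram_instr list" where
  "arcs_block = [Add 8 3 15]"

definition arc_block :: "ram_instr list" where
  "arc_block =
     [Load 10 9, Add 10 5 10, Add 9 9 1, Load 11 9, Add 11 4 11, Load 11 11, Load 12 10,
      Sub 12 12 11, Store 10 12, Add 9 9 1, Sub 8 8 1]"

definition next_block :: "ram_instr list" where
  "next_block = [Sub 7 7 1]"

definition round_code :: ram_code where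
  "round_code =
     (\<lambda>_. round_block) ;; loop_code 8 (\<lambda>_. vertex_block) ;;
     (\<lambda>_. arcs_block) ;; loop_code 8 (\<lambda>_. arc_block) ;; (\<lambda>_. next_block)"

definition elimination_code :: ram_code where
  "elimination_code =
     (\<lambda>_. init_block) ;; loop_code 8 (\<lambda>_. read_block) ;; (\<lambda>_. setup_block) ;;
     loop_code 7 round_code"

subsection \<open>Correctness of the two inner loops\<close>

text \<open>The net effect of the two loop bodies, with every address written only once.\<close>

lemma exec_vertex_block:
  assumes "mem s 1 = 1" "mem s 14 = 2" "mem s 9 = f" "mem s 10 = a" "mem s 11 = b"
    and "16 \<le> f" "16 \<le> a" "16 \<le> b" "f \<noteq> a"
  shows "mem (fold ram_exec vertex_block s) = (mem s)(a := 1 - mem s b,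
      0 := mem s 0 - (1 - mem s b), 12 := 2 - mem s f, b := 2 - mem s f,
      9 := Suc f, 10 := Suc a, 11 := Suc b, 8 := mem s 8 - 1)"
    and "inp (fold ram_exec vertex_block s) = inp s"
  using assms by (simp_all add: vertex_block_def)

lemma exec_arc_block:
  assumes "mem s 1 = 1" "mem s 9 = p" "mem s p = t" "mem s (Suc p) = h" 
    and "mem s 4 = A" "mem s 5 = B" "16 \<le> p" "16 \<le> A" "16 \<le> B"
  shows "mem (fold ram_exec arc_block s) = (mem s)(10 := B + t, 11 := mem s (A + h),
      12 := mem s (B + t) - mem s (A + h), B + t := mem s (B + t) - mem s (A + h), 
      9 := Suc (Suc p), 8 := mem s 8 - 1)"
    and "inp (fold ram_exec arc_block s) = inp s"
  using assms by (simp_all add: arc_block_def)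
text \<open>Access to the list of arcs in the encoding.\<close>

lemma length_concat_pairs: "length (concat (map (\<lambda>e. [f e, g e]) [0..<k])) = 2 * k"
  by (induction k) simp_all

lemma nth_concat_pairs:
  assumes "e < k"
  shows "concat (map (\<lambda>e. [f e, g e]) [0..<k]) ! (2 * e) = f e"
    and "concat (map (\<lambda>e. [f e, g e]) [0..<k]) ! Suc (2 * e) = g e"
  using assms by (induction k) (auto simp: nth_append length_concat_pairs less_Suc_eq)

text \<open>
  An instance with \<open>n\<close> vertices and \<open>m\<close> arcs. At the boundaries of the straight-line blocks,
  the memory holds no number above \<open>M\<close>; the addresses used are themselves among these numbers.
\<close>

locale elimination_instance = fin_digraph G for G :: "(nat, nat) pre_digraph" +
  fixes X :: "nat set" and n m M :: nat
  assumes verts_eq: "verts G = {..<n}" and arcs_eq: "arcs G = {..<m}"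
    and M_ge: "16 + 3 * n + 2 * m \<le> M"
begin

lemma tail_less: "e < m \<Longrightarrow> tail G e < n" and head_less: "e < m \<Longrightarrow> head G e < n"
  using tail_in_verts[of e] head_in_verts[of e] by (auto simp: verts_eq arcs_eq)

text \<open>The contents that stay fixed during the rounds, and the bound on the whole memory.\<close>

definition env :: "(nat \<Rightarrow> nat) \<Rightarrow> bool" where
  "env \<mu> \<longleftrightarrow> \<mu> 1 = 1 \<and> \<mu> 2 = n \<and> \<mu> 3 = m \<and> \<mu> 4 = 16 + n + 2 * m \<and>
     \<mu> 5 = 16 + n + 2 * m + n \<and> \<mu> 14 = 2 \<and> \<mu> 15 = 0 \<and>
     (\<forall>v < n. \<mu> (16 + v) = of_bool (v \<in> X)) \<and>
     (\<forall>e < m. \<mu> (16 + n + 2 * e) = tail G e \<and> \<mu> (Suc (16 + n + 2 * e)) = head G e) \<and>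
     bounded_by M \<mu>"

lemma env_upd:
  assumes env: "env \<mu>" and a: "a \<in> {0, 7, 8, 9, 10, 11, 12} \<or> 16 + n + 2 * m \<le> a"
    and x: "x \<le> M"
  shows "env (\<mu>(a := x))"
proof -
  have "(\<mu>(a := x)) b = \<mu> b" if "b \<in> {1, 2, 3, 4, 5, 14, 15}" for b
    using a that by auto
  moreover have "(\<mu>(a := x)) b = \<mu> b" if "16 \<le> b" "b < 16 + n + 2 * m" for b
    using a that by auto
  moreover have "16 + n + 2 * e < 16 + n + 2 * m" "Suc (16 + n + 2 * e) < 16 + n + 2 * m" if "e < m" for e
    using that by linarith+
  moreover have "bounded_by M (\<mu>(a := x))"
    using env x unfolding env_def by (intro bounded_by_upd) simp_all
  ultimately show ?thesis
    using env unfolding env_def by (simp del: fun_upd_apply add_Suc)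
qed

lemma envD:
  assumes "env \<mu>"
  shows "\<mu> 1 = 1" "\<mu> (Suc 0) = 1" "\<mu> 2 = n" "\<mu> 3 = m" "\<mu> 4 = 16 + n + 2 * m"
    "\<mu> 5 = 16 + n + 2 * m + n" "\<mu> 14 = 2" "\<mu> 15 = 0"
    "v < n \<Longrightarrow> \<mu> (16 + v) = of_bool (v \<in> X)"
    "e < m \<Longrightarrow> \<mu> (16 + n + 2 * e) = tail G e"
    "e < m \<Longrightarrow> \<mu> (Suc (16 + n + 2 * e)) = head G e"
    "bounded_by M \<mu>"
  using assms by (simp_all add: env_def)

text \<open>The slack of \<open>v\<close> with respect to the survivors \<open>S\<close> after the first \<open>k\<close> arcs.\<close>

definition slack :: "nat set \<Rightarrow> nat \<Rightarrow> nat \<Rightarrow> nat" where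
  "slack S k v = 2 - of_bool (v \<in> X) - card {e. e < k \<and> tail G e = v \<and> head G e \<in> S}"

lemma slack_0: "slack S 0 v = 2 - of_bool (v \<in> X)"
  by (simp add: slack_def)

lemma slack_Suc: "slack S (Suc k) v = slack S k v - of_bool (tail G k = v \<and> head G k \<in> S)"
proof -
  have "{e. e < Suc k \<and> tail G e = v \<and> head G e \<in> S} =
    (if tail G k = v \<and> head G k \<in> S then insert k else id)
      {e. e < k \<and> tail G e = v \<and> head G e \<in> S}"
    by (auto simp: less_Suc_eq)
  then show ?thesis by (simp add: slack_def)
qed

lemma slack_le: "slack S k v \<le> M"
  using M_ge by (simp add: slack_def)

lemma slack_eq_0_iff:
  assumes "v < n"
  shows "slack S m v = 0 \<longleftrightarrow> v \<in> supported G X S"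
proof -
  have "{e \<in> arcs G. tail G e = v \<and> head G e \<in> S} = {e. e < m \<and> tail G e = v \<and> head G e \<in> S}"
    by (auto simp: arcs_eq)
  then show ?thesis
    unfolding slack_def supported_def using assms by (auto simp: verts_eq)
qed

text \<open>
  The invariants of the two loops of a round after \<open>k\<close> passes. \<open>S\<close> is the set of survivors at the
  beginning of the round, and \<open>c\<close> is the number of remaining rounds, including the current one.
\<close>

definition vertex_inv :: "nat \<Rightarrow> nat set \<Rightarrow> nat \<Rightarrow> ram_assn" where
  "vertex_inv c S k \<mu> w \<longleftrightarrow> env \<mu> \<and> w = [] \<and> \<mu> 7 = c \<and> \<mu> 9 = 16 + k \<and>
     \<mu> 10 = 16 + n + 2 * m + k \<and> \<mu> 11 = 16 + n + 2 * m + n + k \<and>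
     \<mu> 0 = 1 - card {v. v < k \<and> v \<in> S} \<and>
     (\<forall>v < k. \<mu> (16 + n + 2 * m + v) = of_bool (v \<in> S)) \<and>
     (\<forall>v < k. \<mu> (16 + n + 2 * m + n + v) = slack S 0 v) \<and>
     (\<forall>v < n. k \<le> v \<longrightarrow> (\<mu> (16 + n + 2 * m + n + v) = 0 \<longleftrightarrow> v \<in> S))"

definition arc_inv :: "nat \<Rightarrow> nat set \<Rightarrow> nat \<Rightarrow> ram_assn" where
  "arc_inv c S k \<mu> w \<longleftrightarrow> env \<mu> \<and> w = [] \<and> \<mu> 7 = c \<and> \<mu> 9 = 16 + n + 2 * k \<and>
     \<mu> 0 = 1 - card {v. v < n \<and> v \<in> S} \<and>
     (\<forall>v < n. \<mu> (16 + n + 2 * m + v) = of_bool (v \<in> S)) \<and>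
     (\<forall>v < n. \<mu> (16 + n + 2 * m + n + v) = slack S k v)"

lemma vertex_inv_step:
  assumes inv: "vertex_inv c S k \<mu> w" and k: "k < n" and \<mu>8: "\<mu> 8 = n - k"
    and upd: "\<mu>' = \<mu>(a := 1 - \<mu> b, 0 := \<mu> 0 - (1 - \<mu> b), 12 := 2 - \<mu> f, b := 2 - \<mu> f,
      9 := Suc f, 10 := Suc a, 11 := Suc b, 8 := \<mu> 8 - 1)"
    and addr: "f = 16 + k" "a = 16 + n + 2 * m + k" "b = 16 + n + 2 * m + n + k"
  shows "vertex_inv c S (Suc k) \<mu>' w \<and> \<mu>' 8 = n - Suc k"
proof -
  have env: "env \<mu>" and rest: "w = []" "\<mu> 7 = c" "\<mu> 0 = 1 - card {v. v < k \<and> v \<in> S}"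
    and alive: "\<And>v. v < k \<Longrightarrow> \<mu> (16 + n + 2 * m + v) = of_bool (v \<in> S)"
    and old: "\<And>v. v < k \<Longrightarrow> \<mu> (16 + n + 2 * m + n + v) = slack S 0 v"
    and todo: "\<And>v. v < n \<Longrightarrow> k \<le> v \<Longrightarrow> (\<mu> (16 + n + 2 * m + n + v) = 0 \<longleftrightarrow> v \<in> S)"
    using inv by (simp_all add: vertex_inv_def)
  have b: "1 - \<mu> b = of_bool (k \<in> S)"
    using todo[OF k] by (cases "k \<in> S") (simp_all add: addr)
  have f: "2 - \<mu> f = slack S 0 k"
    using envD(9)[OF env k] by (simp add: addr slack_0)
  have "{v. v < Suc k \<and> v \<in> S} = (if k \<in> S then insert k else id) {v. v < k \<and> v \<in> S}"
    by (auto simp: less_Suc_eq)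
  then have card: "\<mu> 0 - of_bool (k \<in> S) = 1 - card {v. v < Suc k \<and> v \<in> S}"
    by (simp add: rest)
  note \<mu>' = upd[unfolded b f card]
  have "env \<mu>'"
    unfolding \<mu>' using M_ge k slack_le by (intro env_upd env) (simp_all add: addr \<mu>8)
  moreover have "\<mu>' 7 = c" "\<mu>' 9 = 16 + Suc k" "\<mu>' 10 = 16 + n + 2 * m + Suc k"
    "\<mu>' 11 = 16 + n + 2 * m + n + Suc k" "\<mu>' 8 = n - Suc k"
    "\<mu>' 0 = 1 - card {v. v < Suc k \<and> v \<in> S}"
    unfolding \<mu>' by (simp_all add: addr rest \<mu>8)
  moreover have "\<mu>' (16 + n + 2 * m + v) = of_bool (v \<in> S)" if "v < Suc k" for v
    using that k alive[of v] by (cases "v = k") (simp_all add: \<mu>' addr)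
  moreover have "\<mu>' (16 + n + 2 * m + n + v) = slack S 0 v" if "v < Suc k" for v
    using that k old[of v] by (cases "v = k") (simp_all add: \<mu>' addr)
  moreover have "\<mu>' (16 + n + 2 * m + n + v) = 0 \<longleftrightarrow> v \<in> S" if "v < n" "Suc k \<le> v" for v
    using that k todo[of v] by (simp add: \<mu>' addr)
  ultimately show ?thesis
    using rest(1) by (simp add: vertex_inv_def)
qed

lemma vertex_block_correct:
  assumes "k < n"
  shows "triple (\<lambda>\<mu> w. vertex_inv c S k \<mu> w \<and> \<mu> 8 = n - k) (\<lambda>_. vertex_block)
    (block_time M (length vertex_block)) (\<lambda>\<mu> w. vertex_inv c S (Suc k) \<mu> w \<and> \<mu> 8 = n - Suc k)"
proof (rule triple_block)
  show "\<forall>x \<in> set vertex_block. straight M x" by (simp add: vertex_block_def)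
  fix s :: ram_config
  assume inv: "vertex_inv c S k (mem s) (inp s) \<and> mem s 8 = n - k"
  then have env: "env (mem s)" and w: "inp s = []" by (simp_all add: vertex_inv_def)
  show "bounded_by M (mem s)" using envD(12)[OF env] .
  show "j \<le> M" if "j \<in> set (inp s)" for j using w that by simp
  have regs: "mem s 9 = 16 + k" "mem s 10 = 16 + n + 2 * m + k"
    "mem s 11 = 16 + n + 2 * m + n + k"
    using inv by (simp_all add: vertex_inv_def)
  note exec = exec_vertex_block[OF envD(1)[OF env] envD(7)[OF env] regs]
  show "vertex_inv c S (Suc k) (mem (fold ram_exec vertex_block s))
      (inp (fold ram_exec vertex_block s)) \<and> mem (fold ram_exec vertex_block s) 8 = n - Suc k"
    using vertex_inv_step[OF conjunct1[OF inv] assms conjunct2[OF inv] exec(1)] exec(2) assms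
    by simp
qed

lemma arc_inv_step:
  assumes inv: "arc_inv c S k \<mu> w" and k: "k < m" and \<mu>8: "\<mu> 8 = m - k"
    and upd: "\<mu>' = \<mu>(10 := b, 11 := \<mu> a, 12 := \<mu> b - \<mu> a, b := \<mu> b - \<mu> a,
      9 := Suc (Suc p), 8 := \<mu> 8 - 1)"
    and addr: "p = 16 + n + 2 * k" "a = 16 + n + 2 * m + head G k"
      "b = 16 + n + 2 * m + n + tail G k"
  shows "arc_inv c S (Suc k) \<mu>' w \<and> \<mu>' 8 = m - Suc k"
proof -
  have env: "env \<mu>" and rest: "w = []" "\<mu> 7 = c" "\<mu> 0 = 1 - card {v. v < n \<and> v \<in> S}"
    and alive: "\<And>v. v < n \<Longrightarrow> \<mu> (16 + n + 2 * m + v) = of_bool (v \<in> S)"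
    and slk: "\<And>v. v < n \<Longrightarrow> \<mu> (16 + n + 2 * m + n + v) = slack S k v"
    using inv by (simp_all add: arc_inv_def)
  have a: "\<mu> a = of_bool (head G k \<in> S)"
    using alive[OF head_less[OF k]] by (simp add: addr)
  then have b: "\<mu> b - of_bool (head G k \<in> S) = slack S (Suc k) (tail G k)"
    using slk[OF tail_less[OF k]] by (simp add: addr slack_Suc)
  note \<mu>' = upd[unfolded a b]
  have "env \<mu>'"
    unfolding \<mu>' using M_ge k tail_less[OF k] slack_le
    by (intro env_upd env) (simp_all add: addr \<mu>8)
  moreover have "\<mu>' 7 = c" "\<mu>' 9 = 16 + n + 2 * Suc k" "\<mu>' 8 = m - Suc k"
    "\<mu>' 0 = 1 - card {v. v < n \<and> v \<in> S}"
    unfolding \<mu>' by (simp_all add: addr rest \<mu>8)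
  moreover have "\<mu>' (16 + n + 2 * m + v) = of_bool (v \<in> S)" if "v < n" for v
    using that alive[of v] by (simp add: \<mu>' addr)
  moreover have "\<mu>' (16 + n + 2 * m + n + v) = slack S (Suc k) v" if "v < n" for v
    using that slk[of v] by (cases "v = tail G k") (simp_all add: \<mu>' addr slack_Suc[of S k v])
  ultimately show ?thesis
    using rest(1) by (simp add: arc_inv_def)
qed

lemma arc_block_correct:
  assumes "k < m"
  shows "triple (\<lambda>\<mu> w. arc_inv c S k \<mu> w \<and> \<mu> 8 = m - k) (\<lambda>_. arc_block)
    (block_time M (length arc_block)) (\<lambda>\<mu> w. arc_inv c S (Suc k) \<mu> w \<and> \<mu> 8 = m - Suc k)"
proof (rule triple_block)
  show "\<forall>x \<in> set arc_block. straight M x" by (simp add: arc_block_def)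
  fix s :: ram_config
  assume inv: "arc_inv c S k (mem s) (inp s) \<and> mem s 8 = m - k"
  then have env: "env (mem s)" and w: "inp s = []" by (simp_all add: arc_inv_def)
  show "bounded_by M (mem s)" using envD(12)[OF env] .
  show "j \<le> M" if "j \<in> set (inp s)" for j using w that by simp
  have p: "mem s 9 = 16 + n + 2 * k"
    using inv by (simp_all add: arc_inv_def)
  note exec = exec_arc_block[OF envD(1)[OF env] p envD(10,11)[OF env assms] envD(5,6)[OF env]]
  show "arc_inv c S (Suc k) (mem (fold ram_exec arc_block s))
      (inp (fold ram_exec arc_block s)) \<and> mem (fold ram_exec arc_block s) 8 = m - Suc k"
    using arc_inv_step[OF conjunct1[OF inv] assms conjunct2[OF inv] exec(1)] exec(2)
    by simp
qed

subsection \<open>Correctness of a round\<close>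

text \<open>
  After \<open>r\<close> rounds, slack 0 marks the survivors of \<open>r\<close> rounds, whereas the output still refers to the
  survivors of \<open>r - 1\<close> rounds.
\<close>

definition round_inv :: "nat \<Rightarrow> ram_assn" where
  "round_inv r \<mu> w \<longleftrightarrow> env \<mu> \<and> w = [] \<and>
     (\<forall>v < n. \<mu> (16 + n + 2 * m + n + v) = 0 \<longleftrightarrow> v \<in> survivors G X r) \<and>
     (0 < r \<longrightarrow> \<mu> 0 = of_bool (survivors G X (r - 1) = {}))"

lemma round_block_correct:
  "triple (\<lambda>\<mu> w. round_inv r \<mu> w \<and> \<mu> 7 = c) (\<lambda>_. round_block)
    (block_time M (length round_block)) (\<lambda>\<mu> w. vertex_inv c (survivors G X r) 0 \<mu> w \<and> \<mu> 8 = n)"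
proof (rule triple_block)
  show "\<forall>x \<in> set round_block. straight M x" using M_ge by (simp add: round_block_def)
  fix s :: ram_config
  assume inv: "round_inv r (mem s) (inp s) \<and> mem s 7 = c"
  then have env: "env (mem s)" and w: "inp s = []" and c: "mem s 7 = c"
    and slk: "\<And>v. v < n \<Longrightarrow> (mem s (16 + n + 2 * m + n + v) = 0 \<longleftrightarrow> v \<in> survivors G X r)"
    by (simp_all add: round_inv_def)
  show "bounded_by M (mem s)" using envD(12)[OF env] .
  show "j \<le> M" if "j \<in> set (inp s)" for j using w that by simp
  let ?\<mu> = "(mem s)(0 := 1, 9 := 16, 10 := 16 + n + 2 * m, 11 := 16 + n + 2 * m + n, 8 := n)"
  have "mem (fold ram_exec round_block s) = ?\<mu>" "inp (fold ram_exec round_block s) = []"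
    by (simp_all add: round_block_def w envD[OF env])
  moreover have "env ?\<mu>"
    using M_ge by (intro env_upd env) simp_all
  ultimately show "vertex_inv c (survivors G X r) 0 (mem (fold ram_exec round_block s))
      (inp (fold ram_exec round_block s)) \<and> mem (fold ram_exec round_block s) 8 = n"
    using slk by (simp add: vertex_inv_def c)
qed

lemma arcs_block_correct:
  "triple (vertex_inv c S n) (\<lambda>_. arcs_block)
    (block_time M (length arcs_block)) (\<lambda>\<mu> w. arc_inv c S 0 \<mu> w \<and> \<mu> 8 = m)"
proof (rule triple_block)
  show "\<forall>x \<in> set arcs_block. straight M x" by (simp add: arcs_block_def)
  fix s :: ram_config
  assume inv: "vertex_inv c S n (mem s) (inp s)"
  then have env: "env (mem s)" and w: "inp s = []" by (simp_all add: vertex_inv_def)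
  show "bounded_by M (mem s)" using envD(12)[OF env] .
  show "j \<le> M" if "j \<in> set (inp s)" for j using w that by simp
  have "mem (fold ram_exec arcs_block s) = (mem s)(8 := m)" "inp (fold ram_exec arcs_block s) = []"
    by (simp_all add: arcs_block_def w envD[OF env])
  moreover have "env ((mem s)(8 := m))"
    using M_ge by (intro env_upd env) simp_all
  ultimately show "arc_inv c S 0 (mem (fold ram_exec arcs_block s))
      (inp (fold ram_exec arcs_block s)) \<and> mem (fold ram_exec arcs_block s) 8 = m"
    using inv by (simp add: vertex_inv_def arc_inv_def)
qed

lemma next_block_correct:
  "triple (arc_inv c (survivors G X r) m) (\<lambda>_. next_block)
    (block_time M (length next_block)) (\<lambda>\<mu> w. round_inv (Suc r) \<mu> w \<and> \<mu> 7 = c - 1)"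
proof (rule triple_block)
  show "\<forall>x \<in> set next_block. straight M x" by (simp add: next_block_def)
  fix s :: ram_config
  assume inv: "arc_inv c (survivors G X r) m (mem s) (inp s)"
  then have env: "env (mem s)" and w: "inp s = []" and c: "mem s 7 = c"
    and slk: "\<And>v. v < n \<Longrightarrow> mem s (16 + n + 2 * m + n + v) = slack (survivors G X r) m v"
    and "mem s 0 = 1 - card {v. v < n \<and> v \<in> survivors G X r}"
    by (simp_all add: arc_inv_def)
  moreover have sub: "survivors G X r \<subseteq> {..<n}"
    using survivors_subset_verts[of G X r] by (simp add: verts_eq)
  moreover have "{v. v < n \<and> v \<in> survivors G X r} = survivors G X r"
    using sub by auto
  moreover have "finite (survivors G X r)"
    using sub by (rule finite_subset) simp
  ultimately have out: "mem s 0 = of_bool (survivors G X r = {})"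
    by (cases "survivors G X r = {}") (simp_all add: Suc_le_eq card_gt_0_iff)
  show "bounded_by M (mem s)" using envD(12)[OF env] .
  show "j \<le> M" if "j \<in> set (inp s)" for j using w that by simp
  have "mem (fold ram_exec next_block s) = (mem s)(7 := c - 1)" "inp (fold ram_exec next_block s) = []"
    by (simp_all add: next_block_def w c envD[OF env])
  moreover have "env ((mem s)(7 := c - 1))"
    using bounded_byD[OF envD(12)[OF env], of 7] by (intro env_upd env) (simp_all add: c)
  ultimately show "round_inv (Suc r) (mem (fold ram_exec next_block s))
      (inp (fold ram_exec next_block s)) \<and> mem (fold ram_exec next_block s) 7 = c - 1"
    using out slk slack_eq_0_iff by (simp add: round_inv_def)
qed

definition round_time :: nat where
  "round_time = block_time M (length round_block) + (loop_time M n (block_time M (length vertex_block)) +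
     (block_time M (length arcs_block) + (loop_time M m (block_time M (length arc_block)) +
      block_time M (length next_block))))"

lemma round_code_correct:
  "triple (\<lambda>\<mu> w. round_inv r \<mu> w \<and> \<mu> 7 = c) round_code round_time
    (\<lambda>\<mu> w. round_inv (Suc r) \<mu> w \<and> \<mu> 7 = c - 1)"
  unfolding round_code_def round_time_def
proof (intro triple_seq)
  let ?S = "survivors G X r"
  show "triple (\<lambda>\<mu> w. round_inv r \<mu> w \<and> \<mu> 7 = c) (\<lambda>_. round_block)
    (block_time M (length round_block)) (\<lambda>\<mu> w. vertex_inv c ?S 0 \<mu> w \<and> \<mu> 8 = n)"
    by (rule round_block_correct)
  show "triple (\<lambda>\<mu> w. vertex_inv c ?S 0 \<mu> w \<and> \<mu> 8 = n) (loop_code 8 (\<lambda>_. vertex_block))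
    (loop_time M n (block_time M (length vertex_block))) (vertex_inv c ?S n)"
    by (rule triple_loop[OF vertex_block_correct]) (simp_all add: vertex_inv_def envD)
  show "triple (vertex_inv c ?S n) (\<lambda>_. arcs_block)
    (block_time M (length arcs_block)) (\<lambda>\<mu> w. arc_inv c ?S 0 \<mu> w \<and> \<mu> 8 = m)"
    by (rule arcs_block_correct)
  show "triple (\<lambda>\<mu> w. arc_inv c ?S 0 \<mu> w \<and> \<mu> 8 = m) (loop_code 8 (\<lambda>_. arc_block))
    (loop_time M m (block_time M (length arc_block))) (arc_inv c ?S m)"
    by (rule triple_loop[OF arc_block_correct]) (simp_all add: arc_inv_def envD)
  show "triple (arc_inv c ?S m) (\<lambda>_. next_block) (block_time M (length next_block))
    (\<lambda>\<mu> w. round_inv (Suc r) \<mu> w \<and> \<mu> 7 = c - 1)"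
    by (rule next_block_correct)
qed

subsection \<open>Reading the input and correctness of the program\<close>

text \<open>The encoding without its first two numbers.\<close>

definition body_input :: "nat list" where
  "body_input = map (\<lambda>v. if v \<in> X then 1 else 0) [0..<n] @
     concat (map (\<lambda>e. [tail G e, head G e]) [0..<m])"

lemma encode_eq: "encode_instance (G, X) = n # m # body_input"
  by (simp add: encode_instance_def body_input_def verts_eq arcs_eq)

lemma body_input_props:
  shows "length body_input = n + 2 * m"
    and "v < n \<Longrightarrow> body_input ! v = of_bool (v \<in> X)"
    and "e < m \<Longrightarrow> body_input ! (n + 2 * e) = tail G e"
    and "e < m \<Longrightarrow> body_input ! Suc (n + 2 * e) = head G e"
    and "j \<in> set body_input \<Longrightarrow> j \<le> M"
proof -
  show "length body_input = n + 2 * m" by (simp add: body_input_def length_concat_pairs)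
  show "v < n \<Longrightarrow> body_input ! v = of_bool (v \<in> X)"
    by (simp add: body_input_def nth_append)
  show "e < m \<Longrightarrow> body_input ! (n + 2 * e) = tail G e"
    by (simp add: body_input_def nth_append nth_concat_pairs)
  show "e < m \<Longrightarrow> body_input ! Suc (n + 2 * e) = head G e"
    by (simp add: body_input_def nth_append nth_concat_pairs)
  have "tail G e \<le> M" "head G e \<le> M" if "e < m" for e
    using tail_less[OF that] head_less[OF that] M_ge by linarith+
  then show "j \<in> set body_input \<Longrightarrow> j \<le> M"
    using M_ge by (auto simp: body_input_def)
qed

text \<open>
  The invariant of the reading loop after \<open>k\<close> numbers. That the rest of the memory is still 0
  provides the initial slack table.
\<close>

definition read_inv :: "nat \<Rightarrow> ram_assn" where
  "read_inv k \<mu> w \<longleftrightarrow> w = drop k body_input \<and> \<mu> 1 = 1 \<and> \<mu> 2 = n \<and> \<mu> 3 = m \<and>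
     \<mu> 9 = 16 + k \<and> \<mu> 15 = 0 \<and> (\<forall>j < k. \<mu> (16 + j) = body_input ! j) \<and>
     (\<forall>a \<ge> 16 + k. \<mu> a = 0) \<and> bounded_by M \<mu>"

lemma init_block_correct:
  "triple (\<lambda>\<mu> w. \<mu> = (\<lambda>_. 0) \<and> w = encode_instance (G, X)) (\<lambda>_. init_block)
    (block_time M (length init_block)) (\<lambda>\<mu> w. read_inv 0 \<mu> w \<and> \<mu> 8 = n + 2 * m)"
proof (rule triple_block)
  show "\<forall>x \<in> set init_block. straight M x" using M_ge by (simp add: init_block_def)
  fix s :: ram_config
  assume s: "mem s = (\<lambda>_. 0) \<and> inp s = encode_instance (G, X)"
  then have mem: "mem s = (\<lambda>_. 0)" and w: "inp s = n # m # body_input"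
    by (simp_all add: encode_eq)
  show "bounded_by M (mem s)" by (simp add: mem bounded_by_def)
  show "j \<le> M" if "j \<in> set (inp s)" for j using body_input_props(5)[of j] M_ge that w by auto
  have exec: "mem (fold ram_exec init_block s) = (\<lambda>_. 0)(1 := 1, 2 := n, 3 := m, 8 := n + m + m, 9 := 16)"
    "inp (fold ram_exec init_block s) = body_input"
    by (simp_all add: init_block_def mem w)
  have "bounded_by M ((\<lambda>_. 0)(1 := 1, 2 := n, 3 := m, 8 := n + m + m, 9 := 16))"
    using M_ge by (intro bounded_by_upd) (simp_all add: bounded_by_def)
  then show "read_inv 0 (mem (fold ram_exec init_block s))
      (inp (fold ram_exec init_block s)) \<and> mem (fold ram_exec init_block s) 8 = n + 2 * m"
    unfolding exec by (simp add: read_inv_def)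
qed

lemma read_block_correct:
  assumes k: "k < n + 2 * m"
  shows "triple (\<lambda>\<mu> w. read_inv k \<mu> w \<and> \<mu> 8 = n + 2 * m - k) (\<lambda>_. read_block)
    (block_time M (length read_block)) (\<lambda>\<mu> w. read_inv (Suc k) \<mu> w \<and> \<mu> 8 = n + 2 * m - Suc k)"
proof (rule triple_block)
  show "\<forall>x \<in> set read_block. straight M x" by (simp add: read_block_def)
  fix s :: ram_config
  assume inv: "read_inv k (mem s) (inp s) \<and> mem s 8 = n + 2 * m - k"
  then have w: "inp s = drop k body_input" and \<mu>8: "mem s 8 = n + 2 * m - k"
    and regs: "mem s 1 = 1" "mem s (Suc 0) = 1" "mem s 2 = n" "mem s 3 = m" "mem s 9 = 16 + k" "mem s 15 = 0"
    and old: "\<And>j. j < k \<Longrightarrow> mem s (16 + j) = body_input ! j"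
    and zero: "\<And>a. 16 + k \<le> a \<Longrightarrow> mem s a = 0"
    and bdd: "bounded_by M (mem s)"
    by (simp_all add: read_inv_def)
  show "bounded_by M (mem s)" by (rule bdd)
  show "j \<le> M" if "j \<in> set (inp s)" for j
    using that w body_input_props(5) set_drop_subset[of k body_input] by auto
  have len: "k < length body_input" using k body_input_props(1) by simp
  let ?x = "body_input ! k"
  have x: "?x \<le> M" using body_input_props(5) nth_mem[OF len] by blast
  have inp: "inp s = ?x # drop (Suc k) body_input"
    using len by (simp add: w Cons_nth_drop_Suc)
  define \<mu> where "\<mu> = (mem s)(10 := ?x, 16 + k := ?x, 9 := 16 + Suc k, 8 := n + 2 * m - Suc k)"
  have exec: "mem (fold ram_exec read_block s) = \<mu>"
    "inp (fold ram_exec read_block s) = drop (Suc k) body_input"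
    using regs by (simp_all add: read_block_def inp \<mu>_def \<mu>8)
  have "bounded_by M \<mu>"
    unfolding \<mu>_def using M_ge k x by (intro bounded_by_upd bdd) simp_all
  moreover have "\<mu> (16 + j) = body_input ! j" if "j < Suc k" for j
    using that old[of j] by (cases "j = k") (simp_all add: \<mu>_def)
  moreover have "\<mu> a = 0" if "16 + Suc k \<le> a" for a
    using that zero[of a] by (simp add: \<mu>_def)
  moreover have "\<mu> 1 = 1" "\<mu> 2 = n" "\<mu> 3 = m" "\<mu> 9 = 16 + Suc k" "\<mu> 15 = 0" "\<mu> 8 = n + 2 * m - Suc k"
    by (simp_all add: \<mu>_def regs)
  ultimately show "read_inv (Suc k) (mem (fold ram_exec read_block s))
      (inp (fold ram_exec read_block s)) \<and> mem (fold ram_exec read_block s) 8 = n + 2 * m - Suc k"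
    unfolding exec by (simp add: read_inv_def)
qed

lemma setup_block_correct:
  "triple (read_inv (n + 2 * m)) (\<lambda>_. setup_block)
    (block_time M (length setup_block)) (\<lambda>\<mu> w. round_inv 0 \<mu> w \<and> \<mu> 7 = Suc n)"
proof (rule triple_block)
  show "\<forall>x \<in> set setup_block. straight M x" using M_ge by (simp add: setup_block_def)
  fix s :: ram_config
  assume inv: "read_inv (n + 2 * m) (mem s) (inp s)"
  then have w: "inp s = []"
    and regs: "mem s 1 = 1" "mem s (Suc 0) = 1" "mem s 2 = n" "mem s 3 = m"
      "mem s 9 = 16 + n + 2 * m" "mem s 15 = 0"
    and body: "\<And>j. j < n + 2 * m \<Longrightarrow> mem s (16 + j) = body_input ! j"
    and zero: "\<And>a. 16 + n + 2 * m \<le> a \<Longrightarrow> mem s a = 0"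
    and bdd: "bounded_by M (mem s)"
    by (simp_all add: read_inv_def body_input_props(1))
  show "bounded_by M (mem s)" by (rule bdd)
  show "j \<le> M" if "j \<in> set (inp s)" for j using w that by simp
  define \<mu> where "\<mu> = (mem s)(4 := 16 + n + 2 * m, 5 := 16 + n + 2 * m + n, 7 := Suc n, 14 := 2)"
  have exec: "mem (fold ram_exec setup_block s) = \<mu>" "inp (fold ram_exec setup_block s) = []"
    by (simp_all add: setup_block_def w regs \<mu>_def)
  have high: "\<mu> a = mem s a" if "16 \<le> a" for a
    using that by (simp add: \<mu>_def)
  have "\<mu> (16 + v) = of_bool (v \<in> X)" if "v < n" for v
    using that body[of v] by (simp add: high body_input_props(2))
  moreover have "\<mu> (16 + n + 2 * e) = tail G e" if "e < m" for e
    using that body[of "n + 2 * e"] by (simp add: high add.assoc body_input_props(3))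
  moreover have "\<mu> (Suc (16 + n + 2 * e)) = head G e" if "e < m" for e
    using that body[of "Suc (n + 2 * e)"] by (simp add: high add.assoc body_input_props(4))
  moreover have "bounded_by M \<mu>"
    unfolding \<mu>_def using M_ge by (intro bounded_by_upd bdd) simp_all
  ultimately have "env \<mu>"
    by (simp add: env_def \<mu>_def regs)
  moreover have "\<mu> (16 + n + 2 * m + n + v) = 0" if "v < n" for v
    using zero[of "16 + n + 2 * m + n + v"] by (simp add: high)
  ultimately show "round_inv 0 (mem (fold ram_exec setup_block s))
      (inp (fold ram_exec setup_block s)) \<and> mem (fold ram_exec setup_block s) 7 = Suc n"
    unfolding exec by (simp add: round_inv_def verts_eq) (simp add: \<mu>_def)
qed

definition elimination_time :: nat where
  "elimination_time = block_time M (length init_block) +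
     (loop_time M (n + 2 * m) (block_time M (length read_block)) +
     (block_time M (length setup_block) + loop_time M (Suc n) round_time))"

lemma elimination_code_correct:
  "triple (\<lambda>\<mu> w. \<mu> = (\<lambda>_. 0) \<and> w = encode_instance (G, X)) elimination_code elimination_time
    (\<lambda>\<mu> w. \<mu> 0 = of_bool (survivors G X n = {}))"
proof (rule triple_conseq)
  show "triple (\<lambda>\<mu> w. \<mu> = (\<lambda>_. 0) \<and> w = encode_instance (G, X)) elimination_code elimination_time
    (round_inv (Suc n))"
    unfolding elimination_code_def elimination_time_def
  proof (intro triple_seq)
    show "triple (\<lambda>\<mu> w. read_inv 0 \<mu> w \<and> \<mu> 8 = n + 2 * m) (loop_code 8 (\<lambda>_. read_block))
        (loop_time M (n + 2 * m) (block_time M (length read_block))) (read_inv (n + 2 * m))"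
      by (rule triple_loop[OF read_block_correct]) (simp_all add: read_inv_def)
    have "triple (\<lambda>\<mu> w. round_inv r \<mu> w \<and> \<mu> 7 = Suc n - r) round_code round_time
        (\<lambda>\<mu> w. round_inv (Suc r) \<mu> w \<and> \<mu> 7 = Suc n - Suc r)" for r
      using round_code_correct[of r "Suc n - r"] by simp
    then show "triple (\<lambda>\<mu> w. round_inv 0 \<mu> w \<and> \<mu> 7 = Suc n) (loop_code 7 round_code)
        (loop_time M (Suc n) round_time) (round_inv (Suc n))"
      by (rule triple_loop) (simp_all add: round_inv_def envD)
  qed (rule init_block_correct setup_block_correct)+
qed (simp_all add: round_inv_def)

end


section \<open>Polynomial time\<close>

text \<open>
  The polynomials bound the costs in terms of the input size \<open>S\<close>, with \<open>M = 16 + 3 * S\<close> as the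
  bound on the numbers in memory; \<open>[:17, 3:]\<close> stands for \<open>M + 1\<close>.
\<close>

definition block_poly :: "nat \<Rightarrow> nat poly" where
  "block_poly k = smult (k * 2 ^ Suc k) [:17, 3:]"

definition loop_poly :: "nat poly \<Rightarrow> nat poly \<Rightarrow> nat poly" where
  "loop_poly N T = (N + [:2:]) * [:17, 3:] + N * T"

lemma poly_block_poly: "poly (block_poly k) S = block_time (16 + 3 * S) k"
  by (simp add: block_poly_def block_time_def algebra_simps)

lemma poly_loop_poly:
  "poly (loop_poly N T) S = loop_time (16 + 3 * S) (poly N S) (poly T S)"
  by (simp add: loop_poly_def loop_time_def algebra_simps)

definition elimination_poly :: "nat poly" where
  "elimination_poly =
     block_poly (length init_block) +
     (loop_poly [:0, 1:] (block_poly (length read_block)) +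
     (block_poly (length setup_block) +
      loop_poly [:1, 1:]
        (block_poly (length round_block) +
        (loop_poly [:0, 1:] (block_poly (length vertex_block)) +
        (block_poly (length arcs_block) +
        (loop_poly [:0, 1:] (block_poly (length arc_block)) +
         block_poly (length next_block)))))))"

lemma loop_time_mono: "N \<le> N' \<Longrightarrow> T \<le> T' \<Longrightarrow> loop_time M N T \<le> loop_time M N' T'"
  unfolding loop_time_def by (intro add_mono mult_mono) simp_all

lemma (in elimination_instance) elimination_time_le:
  assumes "n + 2 * m \<le> S" "M = 16 + 3 * S"
  shows "elimination_time \<le> poly elimination_poly S"
proof -
  have "poly elimination_poly S = block_time M (length init_block) +
     (loop_time M S (block_time M (length read_block)) +
     (block_time M (length setup_block) + loop_time M (Suc S)
       (block_time M (length round_block) + (loop_time M S (block_time M (length vertex_block)) +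
         (block_time M (length arcs_block) + (loop_time M S (block_time M (length arc_block)) +
          block_time M (length next_block)))))))"
    by (simp add: elimination_poly_def poly_block_poly poly_loop_poly assms(2))
  moreover have "elimination_time \<le> \<dots>"
    unfolding elimination_time_def round_time_def
    using assms(1) by (intro add_mono loop_time_mono order_refl) simp_all
  ultimately show ?thesis by simp
qed

theorem partition_poly_time_decidable:
  "poly_time_decidable encode_instance digraph_instances
     (\<lambda>(G, X). has_acyclic_in_branching_partition G X)"
  unfolding poly_time_decidable_def
proof (rule exI[of _ "elimination_code 0"], rule exI[of _ elimination_poly], rule ballI)
  fix x :: "(nat, nat) pre_digraph \<times> nat set"
  assume x: "x \<in> digraph_instances"
  obtain G X where x_eq: "x = (G, X)" by (cases x)
  obtain n m where G: "fin_digraph G" "loopfree_digraph G" "X \<subseteq> verts G"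
    "verts G = {..<n}" "arcs G = {..<m}"
    using x by (auto simp: digraph_instances_def x_eq)
  interpret fin_digraph G by (rule G(1))
  define S where "S = input_size (encode_instance x)"
  \<comment> \<open>Every number has size at least 1, so the input size is at least the length of the encoding.\<close>
  have "length w \<le> input_size w" for w
    by (induction w) (simp_all add: input_size_def bit_size_def)
  from this[of "encode_instance x"] have "n + 2 * m \<le> S"
    by (simp add: S_def x_eq encode_instance_def G(4,5) length_concat o_def sum_list_triv)
  interpret elimination_instance G X n m "16 + 3 * S"
    by unfold_locales (use G \<open>n + 2 * m \<le> S\<close> in simp_all)
  have Q: "survivors G X n = {} \<longleftrightarrow> has_acyclic_in_branching_partition G X"
    using survivors_empty_iff[OF finite_arcs finite_verts, of X]
      partition_iff_no_self_supporting[OF G(1,2,3)] by (simp add: G(4))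
  let ?s = "ram_init (encode_instance x)"
  have "pc ?s = length ([] :: ram_instr list)" by (simp add: ram_init_def)
  moreover have "mem ?s = (\<lambda>_. 0) \<and> inp ?s = encode_instance (G, X)"
    by (simp add: ram_init_def x_eq)
  ultimately obtain t s' where "t \<le> elimination_time"
    "ram_run ([] @ elimination_code (length ([] :: ram_instr list)) @ []) ?s t s'"
    "pc s' = length ([] :: ram_instr list) + length (elimination_code (length ([] :: ram_instr list)))"
    "mem s' 0 = of_bool (survivors G X n = {})"
    by (rule tripleD[OF elimination_code_correct])
  then have "ram_computes (elimination_code 0) (encode_instance x) t
      (if has_acyclic_in_branching_partition G X then 1 else 0)"
    unfolding ram_computes_def Q by (intro exI[of _ s']) simp
  moreover have "t \<le> poly elimination_poly S"
    using \<open>t \<le> elimination_time\<close> elimination_time_le[OF \<open>n + 2 * m \<le> S\<close>] by simp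
  ultimately show "\<exists>t \<le> poly elimination_poly (input_size (encode_instance x)).
      ram_computes (elimination_code 0) (encode_instance x) t
        (if case x of (G, X) \<Rightarrow> has_acyclic_in_branching_partition G X then 1 else 0)"
    unfolding S_def x_eq by auto
qed

section \<open>Deciding and characterizing acyclic in-branching partitions\<close>

theorem theorem3p3:
  "poly_time_decidable encode_instance digraph_instances
     (\<lambda>(G, X). has_acyclic_in_branching_partition G X) \<and>
   (\<forall>(G :: ('a, 'b) pre_digraph) X.
      fin_digraph G \<longrightarrow> loopfree_digraph G \<longrightarrow> X \<subseteq> verts G \<longrightarrow>
      (has_acyclic_in_branching_partition G X \<longleftrightarrow>
       \<not> (\<exists>H. induced_subgraph H G \<and> verts H \<noteq> {} \<and>
            (\<forall>v \<in> verts H \<inter> X. out_degree H v \<ge> 1) \<and>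
            (\<forall>v \<in> verts H - X. out_degree H v \<ge> 2))))"
  by (intro conjI allI impI partition_poly_time_decidable)
    (simp only: partition_iff_no_self_supporting dense_induced_subgraph_iff_self_supporting)

end
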